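(* Let $T \subset \mathbb{R}^d$ be a non-degenerate simplex (the convex hull of $d+1$ affinely independent points), and let $\lambda_1, \ldots, \lambda_n \ge 0$ be such that the family $-\lambda_1 T, \ldots, -\lambda_n T$ permits a translative covering of $T$. Then $$\sum_{i=1}^n \lambda_i \ge d.$$
   Context: Convex sets $C_1,\ldots,C_n \subset \mathbb{R}^d$ permit a translative covering of $T$ if $T \subset \bigcup_{i=1}^n (C_i + x_i)$ for some $x_1,\ldots,x_n \in \mathbb{R}^d$. Here $-\lambda T = \{-\lambda x : x \in T\}$. *)

theory Defs
  imports "HOL-Analysis.Analysis"
begin

(* Convexity of the sets C i is not built in: it plays no role in the covering
   condition itself. The translates may overlap and may stick out of T. *)
definition permits_translative_covering ::
    "nat \<Rightarrow> (nat \<Rightarrow> 'a::euclidean_space set) \<Rightarrow> 'a set \<Rightarrow> bool" where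
  "permits_translative_covering n C T \<longleftrightarrow>
     (\<exists>x :: nat \<Rightarrow> 'a. T \<subseteq> (\<Union>i\<in>{1..n}. (\<lambda>y. y + x i) ` C i))"

end

theory Submission
  imports Defs
begin

text \<open>In barycentric coordinates a negative homothet of the simplex is a set
  \<open>{y. \<forall>v. L v y \<le> b v}\<close>, where the functionals \<open>L v\<close> add up to zero and the numbers \<open>b v\<close> add
  up to the homothety ratio. If two such sets, with bounds \<open>a\<close> and \<open>b\<close>, share a point, then
  \<open>min a b\<close> has nonnegative sum, so both lie in the set with bounds \<open>max a b\<close>, whose ratio is at
  most the sum of the two ratios. Merging meeting sets as long as possible leaves a cover by
  pairwise disjoint closed sets; as the simplex is connected, one of them contains it, and
  evaluating at the vertices shows that its ratio is at least the dimension.\<close>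

text \<open>\<open>L v x + k v\<close> is the barycentric coordinate of \<open>x\<close> at the
  vertex \<open>v\<close>, split into its linear and its constant part. Coordinates adding up to one
  means that the linear parts cancel and the constants add up to one.\<close>

lemma barycentric_functionals:
  fixes C :: "'a::euclidean_space set"
  assumes "finite C" "C \<noteq> {}" "\<not> affine_dependent C"
  obtains L :: "'a \<Rightarrow> 'a \<Rightarrow> real" and k :: "'a \<Rightarrow> real"
  where "\<And>v. v \<in> C \<Longrightarrow> linear (L v)"
    and "\<And>v w. v \<in> C \<Longrightarrow> w \<in> C \<Longrightarrow> L v w + k v = of_bool (v = w)"
    and "\<And>x. (\<Sum>v\<in>C. L v x) = 0"
    and "(\<Sum>v\<in>C. k v) = 1"
proof -
  obtain p where p: "p \<in> C" using assms(2) by blast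
  let ?D = "C - {p}"
  have C: "C = insert p ?D" "finite ?D" "p \<notin> ?D"
    using p assms(1) by auto
  have ind: "independent ((\<lambda>x. x - p) ` ?D)"
    using affine_dependent_iff_dependent2[OF p] assms(3)
    by (simp add: image_def)
  \<comment> \<open>For \<open>v\<close> in \<open>?D\<close> these are dual to the edge vectors
    \<open>w - p\<close>, extended linearly to the whole space.\<close>
  have "\<exists>g::'a \<Rightarrow> real. linear g \<and> (\<forall>w\<in>?D. g (w - p) = of_bool (w = v))" for v
    using linear_independent_extend[OF ind, of "\<lambda>x. of_bool (x + p = v)"] by auto
  then obtain g :: "'a \<Rightarrow> 'a \<Rightarrow> real" where lin: "\<And>v. linear (g v)"
    and g: "\<And>v w. w \<in> ?D \<Longrightarrow> g v (w - p) = of_bool (w = v)"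
    by metis
  have gp: "g v w - g v p = of_bool (v = w)" if "v \<in> ?D" "w \<in> C" for v w
  proof (cases "w = p")
    case True
    then show ?thesis using that by auto
  next
    case False
    then show ?thesis using that g[of w v] linear_diff[OF lin, of v w p] by auto
  qed
  \<comment> \<open>The coordinate at \<open>p\<close> is one minus all the others, so both sum
    identities hold at every point, even off the affine hull of \<open>C\<close>.\<close>
  define L where "L v x = (if v = p then - (\<Sum>u\<in>?D. g u x) else g v x)" for v x
  define k where "k v = (if v = p then 1 + (\<Sum>u\<in>?D. g u p) else - g v p)" for v
  show thesis
  proof
    show "linear (L v)" for v
    proof (cases "v = p")
      case True
      have "linear (\<lambda>x. - (\<Sum>u\<in>?D. g u x))"
        by (intro linear_compose_neg linear_compose_sum lin ballI)
      then show ?thesis using True by (simp add: L_def[abs_def])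
    next
      case False
      then show ?thesis using lin by (simp add: L_def[abs_def])
    qed
    have off_p: "(\<Sum>v\<in>?D. L v x) = (\<Sum>v\<in>?D. g v x)" "(\<Sum>v\<in>?D. k v) = - (\<Sum>v\<in>?D. g v p)" for x
      unfolding sum_negf[symmetric] by (auto intro!: sum.cong simp: L_def k_def)
    show "(\<Sum>v\<in>C. L v x) = 0" for x
      using off_p sum.insert[OF C(2,3), of "\<lambda>v. L v x"] C(1) by (simp add: L_def)
    show "(\<Sum>v\<in>C. k v) = 1"
      using off_p sum.insert[OF C(2,3), of k] C(1) by (simp add: k_def)
    show "L v w + k v = of_bool (v = w)" if "v \<in> C" "w \<in> C" for v w
    proof (cases "v = p")
      case True
      have "(\<Sum>u\<in>?D. g u w) - (\<Sum>u\<in>?D. g u p) = (\<Sum>u\<in>?D. of_bool (u = w))"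
        unfolding sum_subtractf[symmetric] using gp that by (intro sum.cong) auto
      also have "\<dots> = of_bool (w \<in> ?D)"
        using C(2) by (simp add: of_bool_def sum.delta)
      finally show ?thesis using True that by (auto simp: L_def k_def)
    next
      case False
      then show ?thesis using gp[of v w] that by (auto simp: L_def k_def)
    qed
  qed
qed

text \<open>Induction on the number of sets. Nonnegative sums allow sets to be discarded at the end
  without breaking the bound.\<close>

lemma connected_covered_by_merged_polyhedron:
  fixes L :: "'c \<Rightarrow> 'a::topological_space \<Rightarrow> real" and b :: "'j \<Rightarrow> 'c \<Rightarrow> real"
  assumes "finite J" "connected T" "T \<noteq> {}"
    and cont: "\<And>v. v \<in> C \<Longrightarrow> continuous_on UNIV (L v)"
    and zero: "\<And>x. (\<Sum>v\<in>C. L v x) = 0"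
    and "\<And>j. j \<in> J \<Longrightarrow> (\<Sum>v\<in>C. b j v) \<ge> 0"
    and "T \<subseteq> (\<Union>j\<in>J. {y. \<forall>v\<in>C. L v y \<le> b j v})"
  shows "\<exists>c. (\<Sum>v\<in>C. c v) \<le> (\<Sum>j\<in>J. \<Sum>v\<in>C. b j v) \<and> T \<subseteq> {y. \<forall>v\<in>C. L v y \<le> c v}"
  using assms(1,6,7)
proof (induction "card J" arbitrary: J b rule: less_induct)
  case less
  define Q where "Q c = {y. \<forall>v\<in>C. L v y \<le> c v}" for c
  have closed_Q: "closed (Q c)" for c
  proof -
    have "Q c = (\<Inter>v\<in>C. {y. L v y \<le> c v})" by (auto simp: Q_def)
    then show ?thesis using cont by (auto intro!: closed_INT closed_Collect_le continuous_on_const)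
  qed
  have cover: "T \<subseteq> (\<Union>j\<in>J. Q (b j))" using less.prems(3) by (simp add: Q_def)
  show ?case
  proof (cases "\<exists>i\<in>J. \<exists>j\<in>J. i \<noteq> j \<and> Q (b i) \<inter> Q (b j) \<noteq> {}")
    case True
    then obtain i j y where ij: "i \<in> J" "j \<in> J" "i \<noteq> j" and y: "y \<in> Q (b i)" "y \<in> Q (b j)"
      by blast
    let ?m = "\<lambda>v. max (b i v) (b j v)"
    \<comment> \<open>The merged set takes over index \<open>i\<close> and \<open>j\<close> is
      dropped, so the index set shrinks.\<close>
    let ?b = "b(i := ?m)"
    \<comment> \<open>Both bounds dominate \<open>L v y\<close> at the common point
      \<open>y\<close>, and these values add up to zero.\<close>
    have "0 \<le> (\<Sum>v\<in>C. min (b i v) (b j v))"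
      unfolding zero[of y, symmetric] using y by (intro sum_mono) (auto simp: Q_def)
    moreover have "(\<Sum>v\<in>C. ?m v) + (\<Sum>v\<in>C. min (b i v) (b j v)) = (\<Sum>v\<in>C. b i v) + (\<Sum>v\<in>C. b j v)"
      unfolding sum.distrib[symmetric] by (intro sum.cong) auto
    ultimately have merge: "(\<Sum>v\<in>C. ?m v) \<le> (\<Sum>v\<in>C. b i v) + (\<Sum>v\<in>C. b j v)" by linarith
    have "(\<Sum>v\<in>C. b i v) \<le> (\<Sum>v\<in>C. ?m v)" by (intro sum_mono) auto
    then have nonneg: "(\<Sum>v\<in>C. ?b h v) \<ge> 0" if "h \<in> J - {j}" for h
      using less.prems(2)[of h] less.prems(2)[OF ij(1)] that by auto
    have "Q (b i) \<union> Q (b j) \<subseteq> Q ?m" by (auto simp: Q_def le_max_iff_disj)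
    then have "T \<subseteq> (\<Union>h\<in>J - {j}. Q (?b h))"
      using cover ij by (fastforce simp: fun_upd_def)
    then obtain c where c: "(\<Sum>v\<in>C. c v) \<le> (\<Sum>h\<in>J - {j}. \<Sum>v\<in>C. ?b h v)"
      and Tc: "T \<subseteq> {y. \<forall>v\<in>C. L v y \<le> c v}"
      using less.hyps[of "J - {j}" ?b] nonneg less.prems(1) ij card_Diff1_less[of J j]
      unfolding Q_def by blast
    have rest: "(\<Sum>h\<in>J - {j} - {i}. \<Sum>v\<in>C. ?b h v) = (\<Sum>h\<in>J - {j} - {i}. \<Sum>v\<in>C. b h v)"
      by (intro sum.cong) auto
    have "(\<Sum>h\<in>J - {j}. \<Sum>v\<in>C. ?b h v) = (\<Sum>v\<in>C. ?m v) + (\<Sum>h\<in>J - {j} - {i}. \<Sum>v\<in>C. b h v)"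
      using sum.remove[of "J - {j}" i "\<lambda>h. \<Sum>v\<in>C. ?b h v"] rest ij less.prems(1) by simp
    moreover have "(\<Sum>h\<in>J. \<Sum>v\<in>C. b h v)
        = (\<Sum>v\<in>C. b j v) + ((\<Sum>v\<in>C. b i v) + (\<Sum>h\<in>J - {j} - {i}. \<Sum>v\<in>C. b h v))"
      using sum.remove[of J j "\<lambda>h. \<Sum>v\<in>C. b h v"] sum.remove[of "J - {j}" i "\<lambda>h. \<Sum>v\<in>C. b h v"]
        ij less.prems(1) by simp
    ultimately show ?thesis using c merge Tc by (intro exI[of _ c]) auto
  next
    case False
    obtain p i where p: "p \<in> T" "p \<in> Q (b i)" and i: "i \<in> J"
      using cover \<open>T \<noteq> {}\<close> by blast
    \<comment> \<open>\<open>Q (b i)\<close> and \<open>?R\<close> are disjoint closed sets covering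
      the connected set \<open>T\<close>; as \<open>p\<close> lies in the first, \<open>T\<close>
      misses the second.\<close>
    let ?R = "\<Union>j\<in>J - {i}. Q (b j)"
    have "closed ?R" using closed_Q less.prems(1) by auto
    moreover have "Q (b i) \<inter> ?R = {}" using False i by blast
    moreover have "T \<subseteq> Q (b i) \<union> ?R" using cover by blast
    ultimately have "T \<inter> ?R = {}"
      using connected_closedD[OF \<open>connected T\<close>, of "Q (b i)" ?R] closed_Q p by blast
    then have "T \<subseteq> Q (b i)" using cover by blast
    moreover have "(\<Sum>v\<in>C. b i v) \<le> (\<Sum>j\<in>J. \<Sum>v\<in>C. b j v)"
      using less.prems(1,2) i by (intro member_le_sum[of i J "\<lambda>j. \<Sum>v\<in>C. b j v"]) auto
    ultimately show ?thesis by (auto simp: Q_def)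
  qed
qed

theorem theorem3:
  fixes T :: "'a::euclidean_space set" and n :: nat and l :: "nat \<Rightarrow> real"
  assumes "int DIM('a) simplex T"
    and "\<And>i. i \<in> {1..n} \<Longrightarrow> 0 \<le> l i"
    and "permits_translative_covering n (\<lambda>i. (\<lambda>x. - l i *\<^sub>R x) ` T) T"
  shows "(\<Sum>i=1..n. l i) \<ge> real DIM('a)"
proof -
  obtain C where indep: "\<not> affine_dependent C" and card: "card C = DIM('a) + 1"
    and T: "T = convex hull C"
    using assms(1) unfolding simplex_def by force
  have C: "finite C" "C \<noteq> {}" using card card_gt_0_iff[of C] by auto
  obtain L k where lin: "\<And>v. v \<in> C \<Longrightarrow> linear (L v)"
    and vert: "\<And>v w. v \<in> C \<Longrightarrow> w \<in> C \<Longrightarrow> L v w + k v = of_bool (v = w)"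
    and zero: "\<And>x. (\<Sum>v\<in>C. L v x) = 0"
    and one: "(\<Sum>v\<in>C. k v) = (1::real)"
    using barycentric_functionals[OF C indep] by blast
  have pos: "L v x \<ge> - k v" if "v \<in> C" "x \<in> T" for v x
  proof -
    \<comment> \<open>Coordinates are nonnegative on \<open>T\<close>: this half-space is convex and
      contains all vertices.\<close>
    have "convex (L v -` {- k v..})"
      using convex_linear_vimage[OF lin[OF that(1)]] by blast
    moreover have "C \<subseteq> L v -` {- k v..}"
      using vert[OF that(1)] by (force simp: of_bool_def split: if_splits)
    ultimately show ?thesis
      using hull_minimal[of C "L v -` {- k v..}" convex] that(2) T by auto
  qed
  obtain x where x: "T \<subseteq> (\<Union>i\<in>{1..n}. (\<lambda>y. y + x i) ` (\<lambda>x. - l i *\<^sub>R x) ` T)"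
    using assms(3) unfolding permits_translative_covering_def by blast
  \<comment> \<open>For \<open>t\<close> in \<open>T\<close>,
    \<open>L v (x i - l i *\<^sub>R t)\<close> equals \<open>L v (x i) - l i * L v t\<close>, and
    \<open>L v t\<close> is at least \<open>- k v\<close>.\<close>
  define b where "b i v = L v (x i) + l i * k v" for i v
  have sum_b: "(\<Sum>v\<in>C. b i v) = l i" for i
    by (simp add: b_def sum.distrib zero one flip: sum_distrib_left)
  have "L v (- l i *\<^sub>R t + x i) \<le> b i v" if "v \<in> C" "t \<in> T" "i \<in> {1..n}" for v t i
    using mult_left_mono[OF pos[OF that(1,2)] assms(2)[OF that(3)]]
    by (simp add: b_def linear_diff[OF lin[OF that(1)]] linear_scale[OF lin[OF that(1)]])
  then have "(\<lambda>y. y + x i) ` (\<lambda>x. - l i *\<^sub>R x) ` T \<subseteq> {y. \<forall>v\<in>C. L v y \<le> b i v}"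
    if "i \<in> {1..n}" for i
    using that by blast
  then have "T \<subseteq> (\<Union>i\<in>{1..n}. {y. \<forall>v\<in>C. L v y \<le> b i v})"
    by (rule order_trans[OF x UN_mono[OF order_refl]])
  moreover have "connected T" "T \<noteq> {}"
    using C T by (auto simp: convex_connected)
  moreover have "continuous_on UNIV (L v)" if "v \<in> C" for v
    using linear_continuous_on lin[OF that] linear_conv_bounded_linear by blast
  ultimately obtain c where c: "(\<Sum>v\<in>C. c v) \<le> (\<Sum>i=1..n. l i)"
    and Tc: "T \<subseteq> {y. \<forall>v\<in>C. L v y \<le> c v}"
    using connected_covered_by_merged_polyhedron[of "{1..n}" T C L b] zero assms(2)
    unfolding sum_b by blast
  \<comment> \<open>The vertex \<open>v\<close> lies in \<open>T\<close> and has coordinate one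
    there, so \<open>L v v = 1 - k v\<close>. Over all \<open>DIM('a) + 1\<close> vertices these
    values add up to \<open>DIM('a)\<close>.\<close>
  have "1 - k v \<le> c v" if "v \<in> C" for v
    using Tc hull_inc[OF that, of convex] vert[OF that that] that by (force simp: T)
  then have "(\<Sum>v\<in>C. 1 - k v) \<le> (\<Sum>v\<in>C. c v)" by (rule sum_mono)
  then show ?thesis using c card one by (simp add: sum_subtractf)
qed

end
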